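(* Let $G$ be a countable group whose lower central series $(G_k)_{k\ge0}$ satisfies $\bigcap_{k=0}^\infty G_k=\{1\}$. Then the set $\mathrm{SZR}(G)$ of standard preorders on $G$ is compact for the Inverse topology and for the Patch topology.
   Context: $\mathrm{ZR}(G)$ is the set of bi-invariant preorders on $G$: binary relations $\preceq$ that are total ($u\preceq v$ or $v\preceq u$ for all $u,v\in G$), transitive, and satisfy $u\preceq v\Rightarrow wu\preceq wv$ and $uw\preceq vw$. Write $u\prec v$ if $u\preceq v$ and not $v\preceq u$. Lower central series: $G_0=G$ and $G_{k+1}=[G,G_k]$. A preorder $\preceq\in\mathrm{ZR}(G)$ is standard if for every $k\ge 0$ and every $g\in G_k\setminus G_{k+1}$ which is positive (i.e. $g\succ1$), all elements of $gG_{k+1}$ are positive. $\mathrm{SZR}(G)$ is the set of standard preorders. Topologies: for $u\in G$ let $\mathcal{O}_u=\{\preceq\in\mathrm{ZR}(G)\mid u\succeq 1\}$ and $\mathcal{U}_u=\{\preceq\in\mathrm{ZR}(G)\mid u\succ1\}$. The Inverse topology on $\mathrm{ZR}(G)$ is generated by the sets $\mathcal{U}_u$, $u\in G$; the Patch topology is generated by all the sets $\mathcal{U}_u$ and $\mathcal{O}_u$, $u\in G$. $\mathrm{SZR}(G)$ carries the subspace topology. Compact means that every open cover has a finite subcover (no Hausdorff condition). *)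

theory Defs
  imports "HOL-Algebra.Generated_Groups" "HOL-Analysis.Function_Topology"
begin

text \<open>Binary relations on a group \<open>G\<close> are sets of pairs inside
  \<open>carrier G \<times> carrier G\<close>, with \<open>(u, v) \<in> R\<close> for \<open>u \<preceq> v\<close>. The support
  condition makes two relations equal as soon as they agree on \<open>G\<close>.\<close>

definition ZR :: "('a, 'b) monoid_scheme \<Rightarrow> ('a \<times> 'a) set set" where
  "ZR G = {R. R \<subseteq> carrier G \<times> carrier G \<and>
     (\<forall>u \<in> carrier G. \<forall>v \<in> carrier G. (u, v) \<in> R \<or> (v, u) \<in> R) \<and>
     trans R \<and>
     (\<forall>u \<in> carrier G. \<forall>v \<in> carrier G. \<forall>w \<in> carrier G. (u, v) \<in> R \<longrightarrow>
        (w \<otimes>\<^bsub>G\<^esub> u, w \<otimes>\<^bsub>G\<^esub> v) \<in> R \<and> (u \<otimes>\<^bsub>G\<^esub> w, v \<otimes>\<^bsub>G\<^esub> w) \<in> R)}"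

definition strictly_below :: "('a \<times> 'a) set \<Rightarrow> 'a \<Rightarrow> 'a \<Rightarrow> bool" where
  "strictly_below R u v \<longleftrightarrow> (u, v) \<in> R \<and> (v, u) \<notin> R"

definition positive :: "('a, 'b) monoid_scheme \<Rightarrow> ('a \<times> 'a) set \<Rightarrow> 'a \<Rightarrow> bool" where
  "positive G R g \<longleftrightarrow> strictly_below R \<one>\<^bsub>G\<^esub> g"

primrec lower_central_series :: "('a, 'b) monoid_scheme \<Rightarrow> nat \<Rightarrow> 'a set" where
  "lower_central_series G 0 = carrier G"
| "lower_central_series G (Suc k) = generate G
     {x \<otimes>\<^bsub>G\<^esub> y \<otimes>\<^bsub>G\<^esub> inv\<^bsub>G\<^esub> x \<otimes>\<^bsub>G\<^esub> inv\<^bsub>G\<^esub> y | x y.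
        x \<in> carrier G \<and> y \<in> lower_central_series G k}"

definition standard :: "('a, 'b) monoid_scheme \<Rightarrow> ('a \<times> 'a) set \<Rightarrow> bool" where
  "standard G R \<longleftrightarrow>
     (\<forall>k. \<forall>g \<in> lower_central_series G k - lower_central_series G (Suc k).
        positive G R g \<longrightarrow>
        (\<forall>h \<in> g <#\<^bsub>G\<^esub> lower_central_series G (Suc k). positive G R h))"

definition SZR :: "('a, 'b) monoid_scheme \<Rightarrow> ('a \<times> 'a) set set" where
  "SZR G = {R \<in> ZR G. standard G R}"

definition ZR_nonneg :: "('a, 'b) monoid_scheme \<Rightarrow> 'a \<Rightarrow> ('a \<times> 'a) set set" where
  "ZR_nonneg G u = {R \<in> ZR G. (\<one>\<^bsub>G\<^esub>, u) \<in> R}"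

definition ZR_pos :: "('a, 'b) monoid_scheme \<Rightarrow> 'a \<Rightarrow> ('a \<times> 'a) set set" where
  "ZR_pos G u = {R \<in> ZR G. positive G R u}"

text \<open>The whole space has to be put into the subbasis by hand: the preorder
  \<open>carrier G \<times> carrier G\<close> lies in no \<open>ZR_pos G u\<close>, and the \<open>topspace\<close> of
  \<^const>\<open>topology_generated_by\<close> is only the union of the subbasis.\<close>

definition inverse_topology :: "('a, 'b) monoid_scheme \<Rightarrow> ('a \<times> 'a) set topology" where
  "inverse_topology G = topology_generated_by (insert (ZR G) (ZR_pos G ` carrier G))"

definition patch_topology :: "('a, 'b) monoid_scheme \<Rightarrow> ('a \<times> 'a) set topology" where
  "patch_topology G = topology_generated_by
     (insert (ZR G) (ZR_pos G ` carrier G \<union> ZR_nonneg G ` carrier G))"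

lemma topspace_inverse_topology: "topspace (inverse_topology G) = ZR G"
  by (auto simp: inverse_topology_def ZR_pos_def)

lemma topspace_patch_topology: "topspace (patch_topology G) = ZR G"
  by (auto simp: patch_topology_def ZR_pos_def ZR_nonneg_def)

end

theory Submission
  imports Defs
begin

text \<open>A relation on \<open>G\<close> is a point of the Cantor cube \<open>2\<^bsup>G \<times> G\<^esup>\<close>, which is compact by
  Tychonoff's theorem. Every axiom of a preorder in \<open>ZR G\<close> is a conjunction, possibly
  infinite, of conditions that each look at finitely many pairs, so it cuts out a closed subset
  of the cube.
  The same is true of standardness: although it is usually read as a statement about whole cosets,
  it says of each single \<open>h \<in> g G\<^bsub>k+1\<^esub>\<close> that either \<open>g\<close> is not positive or \<open>h\<close> is, which is a clopen
  condition on four pairs. Hence \<open>SZR G\<close> is closed in the cube, and therefore compact in the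
  product topology. The patch topology is generated by conditions on at most two pairs, so it is no
  finer than the product topology on \<open>ZR G\<close>, and the inverse topology is no finer than the patch
  topology; compactness passes to both.\<close>

lemma compact_UNIV_bool_cube: "compact (UNIV :: ('i \<Rightarrow> bool) set)"
proof -
  have "compact_space (product_topology (\<lambda>i. euclidean :: bool topology) (UNIV :: 'i set))"
    unfolding compact_space_product_topology by (simp add: compact_space_def finite_imp_compact)
  then show ?thesis
    by (simp add: compact_space_def euclidean_product_topology)
qed

text \<open>Reading off one coordinate of the cube is continuous into a discrete space. These two
  facts are where all open and closed conditions below come from.\<close>

lemma open_Collect_apply: "open {f :: 'i \<Rightarrow> bool. f i}"
  using open_vimage[OF open_discrete[of "{True}"] continuous_on_product_coordinates[of i]]
  by (simp add: vimage_def)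

lemma closed_Collect_apply: "closed {f :: 'i \<Rightarrow> bool. f i}"
  using closed_vimage[OF closed_singleton[of True] continuous_on_product_coordinates[of i]]
  by (simp add: vimage_def)

lemmas closed_condition_intros =
  closed_Collect_all closed_Collect_conj closed_Collect_disj closed_Collect_imp
  closed_Collect_neg closed_Collect_const closed_Collect_apply
  open_Collect_conj open_Collect_neg open_Collect_const open_Collect_apply

lemma closed_ZR: "closed {f. Collect f \<in> ZR G}"
  unfolding ZR_def trans_def subset_iff mem_Times_iff Ball_def mem_Collect_eq
  by (intro closed_condition_intros)

lemma closed_standard: "closed {f. standard G (Collect f)}"
  unfolding standard_def positive_def strictly_below_def Ball_def mem_Collect_eq
  by (intro closed_condition_intros)

lemma closed_SZR: "closed {f. Collect f \<in> SZR G}"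
  using closed_Collect_conj[OF closed_ZR closed_standard] by (simp add: SZR_def)

text \<open>\<open>Collect\<close> identifies points of the cube with relations. The subbasic sets of the patch
  topology are intersections of \<open>ZR G\<close> with cylinders, so every patch-open set is already open
  in the product topology.\<close>

lemma continuous_map_cube_patch:
  "continuous_map (top_of_set {f. Collect f \<in> ZR G}) (patch_topology G) Collect"
  unfolding patch_topology_def
proof (rule continuous_on_generated_topo)
  let ?Z = "{f. Collect f \<in> ZR G}"
  fix U
  assume "U \<in> insert (ZR G) (ZR_pos G ` carrier G \<union> ZR_nonneg G ` carrier G)"
  then consider "U = ZR G" | u where "U = ZR_pos G u" | u where "U = ZR_nonneg G u"
    by blast
  then obtain W where "open W" "Collect -` U \<inter> ?Z = ?Z \<inter> W"
  proof cases
    case 1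
    then show ?thesis
      by (intro that[of UNIV]) auto
  next
    case (2 u)
    have "open {f. f (\<one>\<^bsub>G\<^esub>, u) \<and> \<not> f (u, \<one>\<^bsub>G\<^esub>)}"
      by (intro closed_condition_intros)
    with 2 show ?thesis
      by (intro that) (auto simp: ZR_pos_def positive_def strictly_below_def)
  next
    case (3 u)
    then show ?thesis
      by (intro that[OF open_Collect_apply[of "(\<one>\<^bsub>G\<^esub>, u)"]]) (auto simp: ZR_nonneg_def)
  qed
  then show "openin (top_of_set ?Z) (Collect -` U \<inter> topspace (top_of_set ?Z))"
    by (auto simp: openin_open)
qed auto

lemma compactin_patch_if_closed:
  assumes "closed {f. Collect f \<in> \<S>}" and "\<S> \<subseteq> ZR G"
  shows "compactin (patch_topology G) \<S>"
proof -
  let ?A = "{f. Collect f \<in> \<S>}"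
  have "compact ?A"
    using compact_Int_closed[OF compact_UNIV_bool_cube assms(1)] by simp
  then have "compactin (top_of_set {f. Collect f \<in> ZR G}) ?A"
    using assms(2) by (auto simp: compactin_subtopology)
  then have "compactin (patch_topology G) (Collect ` ?A)"
    by (rule image_compactin[OF _ continuous_map_cube_patch])
  moreover have "Collect ` ?A = \<S>"
    using surj_image_vimage_eq[of Collect \<S>] surjI[of Collect "\<lambda>R p. p \<in> R"]
    by (simp add: vimage_def)
  ultimately show ?thesis
    by simp
qed

lemma continuous_map_patch_inverse:
  "continuous_map (patch_topology G) (inverse_topology G) (\<lambda>R. R)"
  unfolding inverse_topology_def
proof (rule continuous_on_generated_topo)
  fix U
  assume U: "U \<in> insert (ZR G) (ZR_pos G ` carrier G)"
  then have "openin (patch_topology G) U"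
    unfolding patch_topology_def by (intro topology_generated_by_Basis) blast
  then show "openin (patch_topology G) ((\<lambda>R. R) -` U \<inter> topspace (patch_topology G))"
    by (simp add: openin_Int)
qed (auto simp: topspace_patch_topology)

theorem corollary4p5:
  fixes G :: "('a, 'b) monoid_scheme"
  assumes "group G"
    and "countable (carrier G)"
    and "(\<Inter>k. lower_central_series G k) = {\<one>\<^bsub>G\<^esub>}"
  shows "compact_space (subtopology (inverse_topology G) (SZR G)) \<and>
         compact_space (subtopology (patch_topology G) (SZR G))"
proof -
  have patch: "compactin (patch_topology G) (SZR G)"
    using closed_SZR by (rule compactin_patch_if_closed) (auto simp: SZR_def)
  from image_compactin[OF this continuous_map_patch_inverse]
  have "compactin (inverse_topology G) (SZR G)"
    by simp
  with patch show ?thesis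
    by (simp add: compact_space_subtopology)
qed

end
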